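(* Let $G=(V,E)$ be a finite simple graph with $V=\{1,\dots,n\}$, $n\ge1$, and let $c\in\mathbb{R}$. Let $\mathbf{x}\in\Delta_n$ and let $\mathcal{P}$ be a partition of $\operatorname{supp}(\mathbf{x})$ separating distinct values of $\mathbf{x}$. Let $\mathbb{E}=(V_1,\dots,V_k)$ be an enumeration of $\mathcal{P}$, let $D$ be the edge density matrix associated with $\mathbb{E}$, and set $\Lambda=\operatorname{diag}(|V_1|,\dots,|V_k|)$. Assume $\mathcal{P}$ is equitable for $G[\operatorname{supp}(\mathbf{x})]$. Then $\mathbf{x}\in\mathrm{gKKT}(c)$ if and only if $\operatorname{bary}_{\mathbb{E}}(\mathbf{x})$ is a KKT point for the program $$\max_{\mathbf{y}\in\operatorname{int}\Delta_k}\ \mathbf{y}^\top(D+c\Lambda^{-1})\mathbf{y}.$$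
   Context: Graphs are finite, undirected, unweighted, without loops; $i\sim j$ means $\{i,j\}\in E$. $A$ is the adjacency matrix of $G$, $I$ the identity matrix, $\mathbf 1$ the all-ones vector. $\Delta_m=\{\mathbf{x}\in\mathbb{R}^m:\mathbf{1}^\top\mathbf{x}=1,\ \mathbf{x}\ge\mathbf 0\}$, $\operatorname{int}\Delta_m$ is the set of points of $\Delta_m$ with all coordinates positive, and $\operatorname{supp}(\mathbf{x})=\{i:x_i\ne0\}$. $G[S]$ is the subgraph induced by $S$. $\mathrm{gKKT}(c)$ is the set of generalized KKT points of $\max_{\mathbf{x}\in\Delta_n}\mathbf{x}^\top(A+cI)\mathbf{x}$: the set of $\mathbf{x}\in\Delta_n$ for which there exist $\mu_0\in\mathbb{R}$, $\boldsymbol\mu\in\mathbb{R}^n$ with $2(A+cI)\mathbf{x}+\mu_0\mathbf{1}+\boldsymbol\mu=\mathbf 0$ and $\mu_ix_i=0$ for every $i\in V$ (no sign condition on $\boldsymbol\mu$). For a symmetric $M\in\mathbb{R}^{k\times k}$, $\mathbf{y}$ is a KKT point for $\max_{\mathbf{y}\in\operatorname{int}\Delta_k}\mathbf{y}^\top M\mathbf{y}$ if $\mathbf{y}\in\operatorname{int}\Delta_k$ and there exist $\mu_0\in\mathbb{R}$, $\boldsymbol\mu\in\mathbb{R}^k$ with $2M\mathbf{y}+\mu_0\mathbf{1}+\boldsymbol\mu=\mathbf 0$, $\mu_\ell y_\ell=0$ for all $\ell$, and $\boldsymbol\mu\ge\mathbf 0$. A partition $\mathcal{P}$ of $\operatorname{supp}(\mathbf{x})$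 separates distinct values of $\mathbf{x}$ if whenever $i,j\in\operatorname{supp}(\mathbf{x})$ and $x_i\ne x_j$, the nodes $i,j$ belong to distinct classes of $\mathcal{P}$. An enumeration of $\mathcal{P}$ is a tuple $(V_1,\dots,V_k)$ of distinct sets with $\mathcal{P}=\{V_1,\dots,V_k\}$. A partition $\{V_1,\dots,V_k\}$ of the node set of a graph $G'$ is equitable for $G'$ if for every $\ell,m$ the number of neighbors in $V_m$ of a node $i\in V_\ell$ is a constant $b_{\ell m}$ independent of $i$. For non-empty $S\subseteq V$, $\mathbf{x}^S\in\Delta_n$ is the characteristic vector: $x^S_i=|S|^{-1}$ if $i\in S$, $0$ otherwise. For a tuple $\mathbb{E}=(V_1,\dots,V_k)$ of non-empty pairwise disjoint subsets of $V$ and $\mathbf{x}\in\operatorname{conv}(\mathbf{x}^{V_1},\dots,\mathbf{x}^{V_k})$, $\operatorname{bary}_{\mathbb{E}}(\mathbf{x})$ is the unique $\mathbf{y}\in\Delta_k$ with $\mathbf{x}=\sum_{\ell=1}^k y_\ell\mathbf{x}^{V_\ell}$. (If $\mathbb{E}$ enumerates a partition of $\operatorname{supp}(\mathbf{x})$ separating distinct values of $\mathbf{x}$, then $\mathbf{x}$ lies in this convex hull, so $\operatorname{bary}_{\mathbb{E}}(\mathbf{x})$ is defined.) For non-empty $S_1,S_2\subseteq V$, $e_G(S_1,S_2)=|\{(i,j)\in S_1\times S_2:i\sim j\}|$ and $d_G(S_1,S_2)=e_G(S_1,S_2)/(|S_1||S_2|)$. The edge density matrix associated with $\mathbb{E}$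 is the symmetric $k\times k$ matrix with entries $d_G(V_\ell,V_m)$. *)

theory Defs
  imports "HOL-Analysis.Analysis" "HOL-Library.Disjoint_Sets"
begin

text \<open>A graph is given by its node set and its set of edges. For a graph on the whole of a
  finite type \<open>'n\<close>, the node set is \<open>UNIV\<close> and \<open>n = CARD('n)\<close>. Requiring edges to have
  exactly two elements excludes loops.\<close>

definition simple_graph :: "'a set \<Rightarrow> 'a set set \<Rightarrow> bool" where
  "simple_graph V E \<longleftrightarrow> finite V \<and> (\<forall>e\<in>E. e \<subseteq> V \<and> card e = 2)"

definition adj :: "'a set set \<Rightarrow> 'a \<Rightarrow> 'a \<Rightarrow> bool" where
  "adj E i j \<longleftrightarrow> {i, j} \<in> E"

definition induced_edges :: "'a set set \<Rightarrow> 'a set \<Rightarrow> 'a set set" where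
  "induced_edges E S = {e \<in> E. e \<subseteq> S}"

definition adj_matrix :: "'n::finite set set \<Rightarrow> real^'n^'n" where
  "adj_matrix E = (\<chi> i j. if adj E i j then 1 else 0)"

definition std_simplex :: "(real^'n::finite) set" where
  "std_simplex = {x. (\<Sum>i\<in>UNIV. x $ i) = 1 \<and> (\<forall>i. 0 \<le> x $ i)}"

text \<open>All coordinates positive: the relative interior, not \<^const>\<open>interior\<close>.\<close>

definition int_simplex :: "(real^'n::finite) set" where
  "int_simplex = {x \<in> std_simplex. \<forall>i. 0 < x $ i}"

definition supp :: "real^'n::finite \<Rightarrow> 'n set" where
  "supp x = {i. x $ i \<noteq> 0}"

definition gKKT :: "'n::finite set set \<Rightarrow> real \<Rightarrow> (real^'n) set" where
  "gKKT E c = {x \<in> std_simplex. \<exists>(\<mu>\<^sub>0::real) (\<mu>::real^'n).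
     2 *\<^sub>R ((adj_matrix E + c *\<^sub>R mat 1) *v x) + \<mu>\<^sub>0 *\<^sub>R 1 + \<mu> = 0 \<and>
     (\<forall>i. \<mu> $ i * x $ i = 0)}"

text \<open>Meant for symmetric \<open>M\<close>, where \<open>2 *\<^sub>R (M *v y)\<close> is the gradient of the objective at \<open>y\<close>.\<close>

definition is_KKT_int :: "real^'k^'k \<Rightarrow> real^'k::finite \<Rightarrow> bool" where
  "is_KKT_int M y \<longleftrightarrow> y \<in> int_simplex \<and>
     (\<exists>(\<mu>\<^sub>0::real) (\<mu>::real^'k).
        2 *\<^sub>R (M *v y) + \<mu>\<^sub>0 *\<^sub>R 1 + \<mu> = 0 \<and>
        (\<forall>l. \<mu> $ l * y $ l = 0) \<and> (\<forall>l. 0 \<le> \<mu> $ l))"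

definition separates_values :: "'n set set \<Rightarrow> real^'n::finite \<Rightarrow> bool" where
  "separates_values P x \<longleftrightarrow>
     (\<forall>i\<in>supp x. \<forall>j\<in>supp x. x $ i \<noteq> x $ j \<longrightarrow> \<not> (\<exists>S\<in>P. i \<in> S \<and> j \<in> S))"

text \<open>A tuple \<open>(V\<^sub>1, \<dots>, V\<^sub>k)\<close> is a function on an index type \<open>'k\<close> with \<open>k = CARD('k)\<close>.\<close>

definition enumerates :: "('k::finite \<Rightarrow> 'a set) \<Rightarrow> 'a set set \<Rightarrow> bool" where
  "enumerates Vs P \<longleftrightarrow> inj Vs \<and> range Vs = P"

definition equitable :: "'a set \<Rightarrow> 'a set set \<Rightarrow> 'a set set \<Rightarrow> bool" where
  "equitable V E P \<longleftrightarrow> partition_on V P \<and>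
     (\<forall>S\<in>P. \<forall>T\<in>P. \<exists>b::nat. \<forall>i\<in>S. card {j \<in> T. adj E i j} = b)"

definition char_vec :: "'n set \<Rightarrow> real^'n::finite" where
  "char_vec S = (\<chi> i. if i \<in> S then 1 / real (card S) else 0)"

definition bary :: "('k::finite \<Rightarrow> 'n::finite set) \<Rightarrow> real^'n \<Rightarrow> real^'k" where
  "bary Vs x = (THE y. y \<in> std_simplex \<and> x = (\<Sum>l\<in>UNIV. y $ l *\<^sub>R char_vec (Vs l)))"

text \<open>The description in \<^const>\<open>bary\<close> is proper for enumerations of partitions separating
  distinct values.\<close>

lemma bary_ex1:
  fixes x :: "real^'n::finite" and Vs :: "'k::finite \<Rightarrow> 'n set"
  assumes x: "x \<in> std_simplex" and P: "partition_on (supp x) P"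
    and sep: "separates_values P x" and en: "enumerates Vs P"
  shows "\<exists>!y. y \<in> std_simplex \<and> x = (\<Sum>l\<in>UNIV. y $ l *\<^sub>R char_vec (Vs l))"
proof -
  have inj: "inj Vs" and rng: "range Vs = P" using en by (auto simp: enumerates_def)
  have cover: "(\<Union>l. Vs l) = supp x" using P rng by (auto simp: partition_on_def)
  have ne: "Vs l \<noteq> {}" for l using P rng by (metis partition_on_def rangeI)
  have card: "real (card (Vs l)) > 0" for l using ne by (simp add: card_gt_0_iff)
  have disj: "Vs l \<inter> Vs m = {}" if "l \<noteq> m" for l m
  proof -
    have "Vs l \<noteq> Vs m" using inj that by (meson injD)
    then show ?thesis using P rng unfolding partition_on_def disjoint_def by (metis rangeI)
  qed
  have at: "(\<Sum>l\<in>UNIV. y $ l *\<^sub>R char_vec (Vs l)) $ i = y $ m / card (Vs m)"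
    if "i \<in> Vs m" for y :: "real^'k" and i m
  proof -
    have "(\<Sum>l\<in>UNIV. y $ l *\<^sub>R char_vec (Vs l)) $ i
        = (\<Sum>l\<in>UNIV. if l = m then y $ m / card (Vs m) else 0)"
      unfolding sum_component
      by (rule sum.cong) (use that disj in \<open>auto simp: char_vec_def\<close>)
    then show ?thesis by simp
  qed
  have off: "(\<Sum>l\<in>UNIV. y $ l *\<^sub>R char_vec (Vs l)) $ i = 0"
    if "i \<notin> supp x" for y :: "real^'k" and i
    using that cover unfolding sum_component by (intro sum.neutral) (auto simp: char_vec_def)
  define y :: "real^'k" where "y = (\<chi> l. \<Sum>i\<in>Vs l. x $ i)"
  have y: "y $ l = card (Vs l) * x $ i" if "i \<in> Vs l" for i l
  proof -
    have "x $ j = x $ i" if "j \<in> Vs l" for j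
      using sep that \<open>i \<in> Vs l\<close> cover rng unfolding separates_values_def by blast
    then show ?thesis by (simp add: y_def)
  qed
  have "(\<Sum>l\<in>UNIV. y $ l) = (\<Sum>i\<in>(\<Union>l. Vs l). x $ i)"
    unfolding y_def by (subst sum.UNION_disjoint) (use disj in auto)
  also have "\<dots> = (\<Sum>i\<in>UNIV. x $ i)"
    unfolding cover by (rule sum.mono_neutral_left) (auto simp: supp_def)
  finally have "y \<in> std_simplex"
    using x by (auto simp: std_simplex_def y_def intro!: sum_nonneg)
  moreover have "x = (\<Sum>l\<in>UNIV. y $ l *\<^sub>R char_vec (Vs l))"
  proof (rule iffD2[OF vec_eq_iff], rule allI)
    fix i
    show "x $ i = (\<Sum>l\<in>UNIV. y $ l *\<^sub>R char_vec (Vs l)) $ i"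
    proof (cases "i \<in> supp x")
      case True
      then obtain m where m: "i \<in> Vs m" using cover by blast
      show ?thesis using at[OF m, of y] y[OF m] card[of m] by (simp add: ne)
    next
      case False
      then show ?thesis using off[OF False, of y] by (simp add: supp_def)
    qed
  qed
  moreover have "z = y"
    if z: "x = (\<Sum>l\<in>UNIV. z $ l *\<^sub>R char_vec (Vs l))" for z
  proof (rule iffD2[OF vec_eq_iff], rule allI)
    fix l
    obtain i where i: "i \<in> Vs l" using ne by blast
    have "x $ i = z $ l / card (Vs l)" using at[OF i, of z] z by simp
    then show "z $ l = y $ l" using y[OF i] card[of l] by (simp add: ne)
  qed
  ultimately show ?thesis by blast
qed

definition edge_count :: "'a set set \<Rightarrow> 'a set \<Rightarrow> 'a set \<Rightarrow> nat" where
  "edge_count E S T = card {(i, j) \<in> S \<times> T. adj E i j}"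

definition edge_density :: "'a set set \<Rightarrow> 'a set \<Rightarrow> 'a set \<Rightarrow> real" where
  "edge_density E S T = real (edge_count E S T) / (real (card S) * real (card T))"

definition edge_density_matrix :: "'a set set \<Rightarrow> ('k::finite \<Rightarrow> 'a set) \<Rightarrow> real^'k^'k" where
  "edge_density_matrix E Vs = (\<chi> l m. edge_density E (Vs l) (Vs m))"

definition diag :: "('k::finite \<Rightarrow> real) \<Rightarrow> real^'k^'k" where
  "diag d = (\<chi> l m. if l = m then d l else 0)"

end

theory Submission
  imports Defs
begin

text \<open>On the support of \<open>x\<close> the multipliers \<open>\<mu>\<close> vanish, and off the support they are
  unconstrained. So \<open>x\<close> is a generalized KKT point iff \<open>(A + cI)x\<close> is constant on the support.
  Likewise, a positive \<open>y\<close> is a KKT point iff \<open>(D + c\<Lambda>\<^sup>-\<^sup>1)y\<close> is constant.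
  Equitability makes each \<open>i \<in> V\<^sub>l\<close> have exactly \<open>d(V\<^sub>l, V\<^sub>m) |V\<^sub>m|\<close> neighbours in \<open>V\<^sub>m\<close>.
  Since \<open>y\<^sub>m = |V\<^sub>m| x\<^sub>j\<close> for \<open>j \<in> V\<^sub>m\<close>, the entry of \<open>(A + cI)x\<close> at any \<open>i \<in> V\<^sub>l\<close> is the
  entry of \<open>(D + c\<Lambda>\<^sup>-\<^sup>1)y\<close> at \<open>l\<close>, so the two conditions coincide.\<close>

lemma gKKT_iff:
  "x \<in> gKKT E c \<longleftrightarrow>
     x \<in> std_simplex \<and> (\<exists>t. \<forall>i\<in>supp x. ((adj_matrix E + c *\<^sub>R mat 1) *v x) $ i = t)"
proof -
  define g where "g = (adj_matrix E + c *\<^sub>R mat 1) *v x"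
  have "(\<exists>(\<mu>\<^sub>0::real) \<mu>. 2 *\<^sub>R g + \<mu>\<^sub>0 *\<^sub>R 1 + \<mu> = 0 \<and> (\<forall>i. \<mu> $ i * x $ i = 0))
      \<longleftrightarrow> (\<exists>t. \<forall>i\<in>supp x. g $ i = t)" (is "?L \<longleftrightarrow> ?R")
  proof
    assume ?L
    then obtain \<mu>\<^sub>0 :: real and \<mu>
      where eq: "2 *\<^sub>R g + \<mu>\<^sub>0 *\<^sub>R 1 + \<mu> = 0" and cs: "\<forall>i. \<mu> $ i * x $ i = 0" by blast
    have "g $ i = - \<mu>\<^sub>0 / 2" if "i \<in> supp x" for i
    proof -
      have "\<mu> $ i = 0" using cs that by (auto simp: supp_def)
      moreover have "2 * g $ i + \<mu>\<^sub>0 + \<mu> $ i = 0"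
        using arg_cong[OF eq, of "\<lambda>v. v $ i"] by simp
      ultimately show ?thesis by simp
    qed
    then show ?R by blast
  next
    assume ?R
    then obtain t where t: "\<forall>i\<in>supp x. g $ i = t" by blast
    \<comment> \<open>The multiplier is whatever stationarity leaves over: it vanishes on the
      support because \<open>g $ i = t\<close> there, while off the support complementarity holds
      through \<open>x $ i = 0\<close>.\<close>
    have "2 *\<^sub>R g + (- 2 * t) *\<^sub>R 1 + (\<chi> i. 2 * t - 2 * g $ i) = 0"
      by (simp add: vec_eq_iff)
    moreover have "\<forall>i. (\<chi> i. 2 * t - 2 * g $ i) $ i * x $ i = 0"
      using t by (auto simp: supp_def)
    ultimately show ?L by blast
  qed
  then show ?thesis by (simp add: gKKT_def g_def)
qed

text \<open>Complementarity at a positive \<open>y\<close> forces \<mu> = 0, so stationarity says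
  exactly that the gradient is constant. Conversely, a constant value \<open>t\<close> is certified
  by \<open>\<mu>\<^sub>0 = - 2 * t\<close> and \<mu> = 0.\<close>

lemma is_KKT_int_iff:
  "is_KKT_int M y \<longleftrightarrow> y \<in> int_simplex \<and> (\<exists>t. \<forall>l. (M *v y) $ l = t)"
proof (cases "y \<in> int_simplex")
  case True
  then have pos: "y $ l \<noteq> 0" for l by (metis (mono_tags, lifting) int_simplex_def mem_Collect_eq less_irrefl)
  have "(\<exists>(\<mu>\<^sub>0::real) \<mu>. 2 *\<^sub>R (M *v y) + \<mu>\<^sub>0 *\<^sub>R 1 + \<mu> = 0 \<and>
          (\<forall>l. \<mu> $ l * y $ l = 0) \<and> (\<forall>l. 0 \<le> \<mu> $ l))
      \<longleftrightarrow> (\<exists>t. \<forall>l. (M *v y) $ l = t)" (is "?L \<longleftrightarrow> ?R")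
  proof
    assume ?L
    then obtain \<mu>\<^sub>0 :: real and \<mu>
      where eq: "2 *\<^sub>R (M *v y) + \<mu>\<^sub>0 *\<^sub>R 1 + \<mu> = 0" and cs: "\<forall>l. \<mu> $ l * y $ l = 0" by blast
    have "(M *v y) $ l = - \<mu>\<^sub>0 / 2" for l
    proof -
      have "\<mu> $ l = 0" using cs pos by simp
      moreover have "2 * (M *v y) $ l + \<mu>\<^sub>0 + \<mu> $ l = 0"
        using arg_cong[OF eq, of "\<lambda>v. v $ l"] by simp
      ultimately show ?thesis by simp
    qed
    then show ?R by blast
  next
    assume ?R
    then obtain t where "\<forall>l. (M *v y) $ l = t" by blast
    then have "2 *\<^sub>R (M *v y) + (- 2 * t) *\<^sub>R 1 + 0 = 0"
      by (simp add: vec_eq_iff)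
    then show ?L by (metis mult_zero_left order_refl zero_index)
  qed
  then show ?thesis using True by (simp add: is_KKT_int_def)
qed (simp add: is_KKT_int_def)

lemma matrix_inv_diag:
  assumes "\<And>l. d l \<noteq> 0"
  shows "matrix_inv (diag d) = diag (\<lambda>l. 1 / d l)"
proof -
  have prod: "diag a ** diag b = diag (\<lambda>l. a l * b l)" for a b :: "'a \<Rightarrow> real"
    by (auto simp: diag_def matrix_matrix_mult_def vec_eq_iff if_distrib[of "\<lambda>z. z * _"] cong: if_cong)
  have "diag (\<lambda>_. 1) = (mat 1 :: real^'a^'a)" by (simp add: diag_def mat_def)
  then have inv: "diag d ** diag (\<lambda>l. 1 / d l) = mat 1" "diag (\<lambda>l. 1 / d l) ** diag d = mat 1"
    using assms by (simp_all add: prod)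
  \<comment> \<open>\<open>matrix_inv\<close> is a Hilbert choice among two-sided inverses; the
    explicit inverse in \<open>inv\<close> shows that the choice is from a nonempty set.
    Associativity then identifies the two inverses.\<close>
  then have "matrix_inv (diag d) ** diag d = mat 1"
    unfolding matrix_inv_def by (rule someI2[where P = "\<lambda>B. diag d ** B = mat 1 \<and> B ** diag d = mat 1", OF conjI]) blast
  then show ?thesis
    by (metis inv(1) matrix_mul_assoc matrix_mul_lid matrix_mul_rid)
qed

lemma diag_mult_vec: "(diag d *v y) $ l = d l * y $ l"
  by (simp add: diag_def matrix_vector_mult_def if_distrib[of "\<lambda>z. z * _"] cong: if_cong)

text \<open>The classes are disjoint, so at coordinate \<open>i\<close> only the term of the class
  containing \<open>i\<close> survives in the barycentric expansion.\<close>

lemma bary_component: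
  fixes x :: "real^'n::finite" and Vs :: "'k::finite \<Rightarrow> 'n set"
  assumes x: "x \<in> std_simplex" and P: "partition_on (supp x) P"
    and sep: "separates_values P x" and en: "enumerates Vs P" and i: "i \<in> Vs l"
  shows "bary Vs x $ l = card (Vs l) * x $ i"
proof -
  have disj: "i \<notin> Vs m" if "m \<noteq> l" for m
  proof -
    have "Vs m \<noteq> Vs l" using en that by (meson enumerates_def injD)
    moreover have "Vs m \<in> P" "Vs l \<in> P" using en by (auto simp: enumerates_def)
    ultimately show ?thesis using P i by (auto simp: partition_on_def disjoint_def)
  qed
  have "x = (\<Sum>m\<in>UNIV. bary Vs x $ m *\<^sub>R char_vec (Vs m))"
    using theI'[OF bary_ex1[OF x P sep en]] unfolding bary_def by blast
  from arg_cong[OF this, of "\<lambda>v. v $ i"]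
  have "x $ i = (\<Sum>m\<in>UNIV. bary Vs x $ m * char_vec (Vs m) $ i)"
    by (simp only: sum_component vector_scaleR_component real_scaleR_def)
  also have "\<dots> = (\<Sum>m\<in>UNIV. if m = l then bary Vs x $ l / card (Vs l) else 0)"
    by (rule sum.cong) (use i disj in \<open>auto simp: char_vec_def\<close>)
  finally have "x $ i = bary Vs x $ l / card (Vs l)" by simp
  moreover have "Vs l \<noteq> {}" using i by blast
  ultimately show ?thesis by simp
qed

text \<open>Counting edges by their endpoint in \<open>S\<close> gives \<open>card S * b\<close>;
  the factor \<open>card S\<close> then cancels.\<close>

lemma edge_density_regular:
  assumes "finite S" "finite T" "S \<noteq> {}" "T \<noteq> {}"
    and "\<And>i. i \<in> S \<Longrightarrow> card {j \<in> T. adj E i j} = b"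
  shows "edge_density E S T * card T = b"
proof -
  have "{(i, j) \<in> S \<times> T. adj E i j} = (SIGMA i:S. {j \<in> T. adj E i j})" by auto
  then have "edge_count E S T = card S * b"
    using assms by (simp add: edge_count_def card_SigmaI)
  then show ?thesis using assms by (simp add: edge_density_def)
qed

lemma equitable_quotient_gradient:
  fixes x :: "real^'n::finite" and Vs :: "'k::finite \<Rightarrow> 'n set"
  assumes x: "x \<in> std_simplex" and P: "partition_on (supp x) P"
    and sep: "separates_values P x" and en: "enumerates Vs P"
    and eq: "equitable (supp x) (induced_edges E (supp x)) P" and i: "i \<in> Vs l"
  shows "((adj_matrix E + c *\<^sub>R mat 1) *v x) $ i =
    ((edge_density_matrix E Vs + c *\<^sub>R matrix_inv (diag (\<lambda>l. real (card (Vs l))))) *v bary Vs x) $ l"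
proof -
  have inj: "inj Vs" and rng: "range Vs = P" using en by (auto simp: enumerates_def)
  have cover: "(\<Union>l. Vs l) = supp x" using P rng by (auto simp: partition_on_def)
  have ne: "Vs l \<noteq> {}" for l using P rng by (metis partition_on_def rangeI)
  have disj: "Vs l \<inter> Vs m = {}" if "l \<noteq> m" for l m
    using P rng inj that unfolding partition_on_def disjoint_def by (metis rangeI injD)
  note y = bary_component[OF x P sep en]
  have block: "(\<Sum>j\<in>Vs m. (if adj E i j then 1 else 0) * x $ j)
      = edge_density E (Vs l) (Vs m) * bary Vs x $ m" for m
  proof -
    have "Vs l \<in> P" "Vs m \<in> P" using rng by auto
    then obtain b where b: "\<forall>i\<in>Vs l. card {j \<in> Vs m. adj (induced_edges E (supp x)) i j} = b"
      using eq unfolding equitable_def by blast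
    \<comment> \<open>Both endpoints lie in the support, so every such edge of the graph survives in
      the induced subgraph.\<close>
    have "{j \<in> Vs m. adj (induced_edges E (supp x)) k j} = {j \<in> Vs m. adj E k j}"
      if "k \<in> Vs l" for k
      using that cover by (auto simp: adj_def induced_edges_def)
    then have deg: "card {j \<in> Vs m. adj E k j} = b" if "k \<in> Vs l" for k
      using b that by simp
    obtain j0 where j0: "j0 \<in> Vs m" using ne by blast
    have "x $ j = x $ j0" if "j \<in> Vs m" for j
      using y[OF that] y[OF j0] ne[of m] by simp
    then have "(\<Sum>j\<in>Vs m. (if adj E i j then 1 else 0) * x $ j)
        = (\<Sum>j\<in>Vs m. if adj E i j then x $ j0 else 0)"
      by (intro sum.cong) auto
    also have "\<dots> = b * x $ j0"
      using deg[OF i] by (simp flip: sum.inter_filter)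
    also have "\<dots> = edge_density E (Vs l) (Vs m) * bary Vs x $ m"
      using edge_density_regular[of "Vs l" "Vs m" E b] deg ne by (simp add: y[OF j0])
    finally show ?thesis .
  qed
  have "(adj_matrix E *v x) $ i = (\<Sum>j\<in>UNIV. (if adj E i j then 1 else 0) * x $ j)"
    by (simp add: adj_matrix_def matrix_vector_mult_def)
  also have "\<dots> = (\<Sum>j\<in>(\<Union>m. Vs m). (if adj E i j then 1 else 0) * x $ j)"
    unfolding cover by (rule sum.mono_neutral_right) (auto simp: supp_def)
  also have "\<dots> = (\<Sum>m\<in>UNIV. edge_density E (Vs l) (Vs m) * bary Vs x $ m)"
    by (subst sum.UNION_disjoint) (use disj block in auto)
  finally have "(adj_matrix E *v x) $ i = (edge_density_matrix E Vs *v bary Vs x) $ l"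
    by (simp add: edge_density_matrix_def matrix_vector_mult_def)
  \<comment> \<open>This accounts for the summand \<open>c *\<^sub>R mat 1\<close>: dividing the
    class total by the class size recovers the common value of \<open>x\<close> on the
    class.\<close>
  moreover have "x $ i = (matrix_inv (diag (\<lambda>l. real (card (Vs l)))) *v bary Vs x) $ l"
    using ne by (simp add: matrix_inv_diag diag_mult_vec y[OF i])
  ultimately show ?thesis
    by (simp add: matrix_vector_mult_add_rdistrib flip: scaleR_matrix_vector_assoc)
qed

theorem theorem4:
  fixes E :: "'n::finite set set"
    and c :: real
    and x :: "real^'n"
    and P :: "'n set set"
    and Vs :: "'k::finite \<Rightarrow> 'n set"
    and D \<Lambda> :: "real^'k^'k"
  assumes "simple_graph UNIV E"
    and "x \<in> std_simplex"
    and "partition_on (supp x) P"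
    and "separates_values P x"
    and "enumerates Vs P"
    and "D = edge_density_matrix E Vs"
    and "\<Lambda> = diag (\<lambda>l. real (card (Vs l)))"
    and "equitable (supp x) (induced_edges E (supp x)) P"
  shows "x \<in> gKKT E c \<longleftrightarrow> is_KKT_int (D + c *\<^sub>R matrix_inv \<Lambda>) (bary Vs x)"
proof -
  have cover: "(\<Union>l. Vs l) = supp x" and ne: "Vs l \<noteq> {}" for l
    using assms(3,5) by (auto simp: partition_on_def enumerates_def)
  have "0 < bary Vs x $ l" for l
  proof -
    obtain i where i: "i \<in> Vs l" using ne by blast
    then have "0 < x $ i" using assms(2) cover by (force simp: std_simplex_def supp_def order_less_le)
    then show ?thesis
      using bary_component[OF assms(2-5) i] ne[of l] by (simp add: card_gt_0_iff)
  qed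
  moreover have "bary Vs x \<in> std_simplex"
    using theI'[OF bary_ex1[OF assms(2-5)]] unfolding bary_def by blast
  ultimately have int: "bary Vs x \<in> int_simplex" by (simp add: int_simplex_def)
  have grad: "((adj_matrix E + c *\<^sub>R mat 1) *v x) $ i = ((D + c *\<^sub>R matrix_inv \<Lambda>) *v bary Vs x) $ l"
    if "i \<in> Vs l" for i l
    using equitable_quotient_gradient[OF assms(2-5,8) that] unfolding assms(6,7) .
  \<comment> \<open>The same \<open>t\<close> serves on both sides: the classes cover the support,
    and each index \<open>l\<close> is reached from some node because \<open>Vs l\<close> is
    nonempty.\<close>
  have "(\<forall>i\<in>supp x. ((adj_matrix E + c *\<^sub>R mat 1) *v x) $ i = t)
      \<longleftrightarrow> (\<forall>l. ((D + c *\<^sub>R matrix_inv \<Lambda>) *v bary Vs x) $ l = t)" for t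
    unfolding cover[symmetric] using grad ne by (metis UN_E UN_I UNIV_I all_not_in_conv)
  then show ?thesis using assms(2) int by (simp add: gKKT_iff is_KKT_int_iff)
qed

end
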